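(* Let the field of scalars be $\mathbb{F}=\mathbb{R}$, and let $\mathcal{H}\subset L^2(X)$ be a real reproducing kernel Hilbert space as described in the context. For every signal $0\neq F\in\mathcal{H}$, one has $$C(F)\ \leq\ 2\sqrt{\mathfrak{C}_F^{-1}-1}+1,$$ where $C(F)$ is the local stability constant of $F$ and $\mathfrak{C}_F$ is the kernel Cheeger constant of $F$. In particular, if $\mathfrak{C}_F>0$, then $F$ does locally stable sign retrieval, i.e. $C(F)<\infty$.
   Context: All spaces are over $\mathbb{R}$, and $a\wedge b=\min\{a,b\}$. Let $(X,\Sigma,\mu)$ be a $\sigma$-finite measure space and $L^2(X)=L^2(X,\Sigma,\mu)$ the space of real-valued square integrable functions. Let $\mathcal{H}\subset\mathbb{R}^X$ be a reproducing kernel Hilbert space: a Hilbert space of functions $X\to\mathbb{R}$ on which every point evaluation $H\mapsto H(x)$ is bounded, so $H(x)=\langle H,k_x\rangle$ for a unique $k_x\in\mathcal{H}$. Assume that $\mathcal{H}$ embeds isometrically into $L^2(X)$; we identify $\mathcal{H}$ with its (closed) image in $L^2(X)$. The reproducing kernel $k(x,y)=\langle k_y,k_x\rangle$ is assumed measurable on $X\times X$. The operator $K:L^2(X)\to L^2(X)$, $(KG)(x)=\int_X G(y)\,k(x,y)\,d\mu(y)=\langle G,k_x\rangle$, is the orthogonal projection onto $\mathcal{H}$. For $S\in\Sigma$ let $P_SH=H\cdot\mathbf{1}_S$, $S^c=X\setminus S$, and $[K,P_S]=KP_S-P_SK$. The local stability constant $C(F)\in[1,\infty]$ is the smallest constant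 $C>0$ such that $\|F-G\|_2\wedge\|F+G\|_2\le C\,\||F|-|G|\|_2$ for all $G\in\mathcal{H}$ ($C(F)=\infty$ if no finite constant works). The kernel Cheeger constant of $0\ne F\in\mathcal{H}$ is $$\mathfrak{C}_F=\inf\left\{\frac{\|[K,P_S]F\|_2^2}{\|P_SF\|_2^2\wedge\|P_{S^c}F\|_2^2}\ :\ S\in\Sigma,\ \|P_SF\|_2>0,\ \|P_{S^c}F\|_2>0\right\}$$ if at least one such $S$ exists, and $\mathfrak{C}_F=1$ otherwise. One has $\mathfrak{C}_F\in[0,1]$. Convention: $0^{-1}=\infty$. *)

theory Defs
  imports "HOL-Analysis.Analysis"
begin

text \<open>
  Real functions on the set \<open>X = space M\<close> are represented by total functions that vanish outside
  \<open>space M\<close>, so that equality of functions on \<open>X\<close> is equality in HOL and the pointwise operations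
  need no restriction.
\<close>

locale real_hilbert_function_space =
  fixes X :: "'a set"
    and H :: "('a \<Rightarrow> real) set"
    and ip :: "('a \<Rightarrow> real) \<Rightarrow> ('a \<Rightarrow> real) \<Rightarrow> real"
  assumes outside: "\<And>f x. f \<in> H \<Longrightarrow> x \<notin> X \<Longrightarrow> f x = 0"
    and zero_mem: "(\<lambda>x. 0) \<in> H"
    and add_mem: "\<And>f g. f \<in> H \<Longrightarrow> g \<in> H \<Longrightarrow> (\<lambda>x. f x + g x) \<in> H"
    and scale_mem: "\<And>c f. f \<in> H \<Longrightarrow> (\<lambda>x. c * f x) \<in> H"
    and ip_commute: "\<And>f g. f \<in> H \<Longrightarrow> g \<in> H \<Longrightarrow> ip f g = ip g f"
    and ip_add_left: "\<And>f g h. f \<in> H \<Longrightarrow> g \<in> H \<Longrightarrow> h \<in> H \<Longrightarrow>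
          ip (\<lambda>x. f x + g x) h = ip f h + ip g h"
    and ip_scale_left: "\<And>c f g. f \<in> H \<Longrightarrow> g \<in> H \<Longrightarrow> ip (\<lambda>x. c * f x) g = c * ip f g"
    and ip_nonneg: "\<And>f. f \<in> H \<Longrightarrow> 0 \<le> ip f f"
    and ip_definite: "\<And>f. f \<in> H \<Longrightarrow> ip f f = 0 \<Longrightarrow> f = (\<lambda>x. 0)"
    and complete: "\<And>u. (\<And>n. u n \<in> H) \<Longrightarrow>
          (\<And>e. 0 < e \<Longrightarrow> \<exists>N. \<forall>m\<ge>N. \<forall>n\<ge>N.
             sqrt (ip (\<lambda>x. u m x - u n x) (\<lambda>x. u m x - u n x)) < e) \<Longrightarrow>
          \<exists>h\<in>H. (\<lambda>n::nat. sqrt (ip (\<lambda>x. u n x - h x) (\<lambda>x. u n x - h x))) \<longlonglongrightarrow> 0"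

locale rkhs = real_hilbert_function_space +
  assumes bounded_evaluation: "\<And>x. x \<in> X \<Longrightarrow> \<exists>B. \<forall>h\<in>H. \<bar>h x\<bar> \<le> B * sqrt (ip h h)"

text \<open>
  The element \<open>k\<^sub>x\<close> of \<open>H\<close> representing evaluation at \<open>x\<close>. In an RKHS it exists uniquely by the
  Riesz representation theorem (and is the zero function for \<open>x \<notin> X\<close>).
\<close>

definition kernel_section ::
    "('a \<Rightarrow> real) set \<Rightarrow> (('a \<Rightarrow> real) \<Rightarrow> ('a \<Rightarrow> real) \<Rightarrow> real) \<Rightarrow> 'a \<Rightarrow> ('a \<Rightarrow> real)" where
  "kernel_section H ip x = (THE k. k \<in> H \<and> (\<forall>h\<in>H. h x = ip h k))"

definition reproducing_kernel ::
    "('a \<Rightarrow> real) set \<Rightarrow> (('a \<Rightarrow> real) \<Rightarrow> ('a \<Rightarrow> real) \<Rightarrow> real) \<Rightarrow> 'a \<Rightarrow> 'a \<Rightarrow> real" where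
  "reproducing_kernel H ip x y = ip (kernel_section H ip y) (kernel_section H ip x)"

definition square_integrable :: "'a measure \<Rightarrow> ('a \<Rightarrow> real) \<Rightarrow> bool" where
  "square_integrable M f \<longleftrightarrow> f \<in> borel_measurable M \<and> integrable M (\<lambda>x. (f x)\<^sup>2)"

definition L2_norm :: "'a measure \<Rightarrow> ('a \<Rightarrow> real) \<Rightarrow> real" where
  "L2_norm M f = sqrt (\<integral>x. (f x)\<^sup>2 \<partial>M)"

locale L2_rkhs = sigma_finite_measure M + rkhs "space M" H ip
  for M :: "'a measure"
    and H :: "('a \<Rightarrow> real) set"
    and ip :: "('a \<Rightarrow> real) \<Rightarrow> ('a \<Rightarrow> real) \<Rightarrow> real" +
  assumes square_integrable_mem: "\<And>f. f \<in> H \<Longrightarrow> square_integrable M f"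
    and isometric: "\<And>f. f \<in> H \<Longrightarrow> L2_norm M f = sqrt (ip f f)"
    and kernel_measurable:
      "(\<lambda>(x, y). reproducing_kernel H ip x y) \<in> borel_measurable (M \<Otimes>\<^sub>M M)"

definition kernel_op :: "'a measure \<Rightarrow> ('a \<Rightarrow> 'a \<Rightarrow> real) \<Rightarrow> ('a \<Rightarrow> real) \<Rightarrow> ('a \<Rightarrow> real)" where
  "kernel_op M k G x = (\<integral>y. G y * k x y \<partial>M)"

definition restrict_op :: "'a set \<Rightarrow> ('a \<Rightarrow> real) \<Rightarrow> ('a \<Rightarrow> real)" where
  "restrict_op S F x = F x * indicator S x"

definition commutator ::
    "(('a \<Rightarrow> real) \<Rightarrow> ('a \<Rightarrow> real)) \<Rightarrow> (('a \<Rightarrow> real) \<Rightarrow> ('a \<Rightarrow> real)) \<Rightarrow>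
     ('a \<Rightarrow> real) \<Rightarrow> ('a \<Rightarrow> real)" where
  "commutator A B F x = A (B F) x - B (A F) x"

text \<open>With no admissible constant the infimum is \<open>Inf {} = \<infinity>\<close>.\<close>

definition local_stability_constant ::
    "'a measure \<Rightarrow> ('a \<Rightarrow> real) set \<Rightarrow> ('a \<Rightarrow> real) \<Rightarrow> ereal" where
  "local_stability_constant M H F =
     Inf {ereal C | C. 0 < C \<and>
       (\<forall>G\<in>H. min (L2_norm M (\<lambda>x. F x - G x)) (L2_norm M (\<lambda>x. F x + G x))
               \<le> C * L2_norm M (\<lambda>x. \<bar>F x\<bar> - \<bar>G x\<bar>))}"

definition locally_stable_sign_retrieval ::
    "'a measure \<Rightarrow> ('a \<Rightarrow> real) set \<Rightarrow> ('a \<Rightarrow> real) \<Rightarrow> bool" where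
  "locally_stable_sign_retrieval M H F \<longleftrightarrow> local_stability_constant M H F < \<infinity>"

definition cheeger_sets :: "'a measure \<Rightarrow> ('a \<Rightarrow> real) \<Rightarrow> 'a set set" where
  "cheeger_sets M F = {S \<in> sets M.
     L2_norm M (restrict_op S F) > 0 \<and> L2_norm M (restrict_op (space M - S) F) > 0}"

definition kernel_cheeger_constant ::
    "'a measure \<Rightarrow> ('a \<Rightarrow> 'a \<Rightarrow> real) \<Rightarrow> ('a \<Rightarrow> real) \<Rightarrow> real" where
  "kernel_cheeger_constant M k F =
     (if cheeger_sets M F \<noteq> {}
      then (INF S\<in>cheeger_sets M F.
              (L2_norm M (commutator (kernel_op M k) (restrict_op S) F))\<^sup>2
              / min ((L2_norm M (restrict_op S F))\<^sup>2)
                    ((L2_norm M (restrict_op (space M - S) F))\<^sup>2))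
      else 1)"

text \<open>Only meaningful on \<open>[0, \<infinity>]\<close>.\<close>

definition ereal_sqrt :: "ereal \<Rightarrow> ereal" where
  "ereal_sqrt x = (if x = \<infinity> then \<infinity> else ereal (sqrt (real_of_ereal x)))"

end

theory Submission
  imports Defs
begin

text \<open>
  Let \<open>T\<close> be the set where \<open>F\<close> and \<open>G\<close> have opposite signs, and \<open>Q = P\<^sub>T F\<close>. Then \<open>F - G = 2Q + E\<close>
  with \<open>\<parallel>E\<parallel> = \<parallel>\<bar>F\<bar> - \<bar>G\<bar>\<parallel>\<close>; likewise for \<open>F + G\<close> with the complement of \<open>T\<close>, so one may pick
  the sign for which \<open>Q\<close> is the smaller part of \<open>F\<close>. Because \<open>K F = F\<close>, the commutator
  \<open>[K, P\<^sub>T] F\<close> is \<open>K Q - Q\<close>, so the Cheeger constant bounds \<open>\<parallel>K Q\<parallel>\<^sup>2 = \<parallel>Q\<parallel>\<^sup>2 - \<parallel>K Q - Q\<parallel>\<^sup>2\<close> by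
  \<open>(1 / \<CC> - 1) \<parallel>K Q - Q\<parallel>\<^sup>2\<close>. Projecting \<open>F - G = 2Q + E\<close> onto \<open>H\<close> and its orthogonal complement
  gives \<open>F - G = 2 K Q + K E\<close> and \<open>2 \<parallel>K Q - Q\<parallel> = \<parallel>K E - E\<parallel> \<le> \<parallel>E\<parallel>\<close>.
\<close>

section \<open>Inner product geometry, Riesz representation and kernel sections\<close>

context real_hilbert_function_space
begin

lemma diff_mem: "f \<in> H \<Longrightarrow> g \<in> H \<Longrightarrow> (\<lambda>x. f x - g x) \<in> H"
  using add_mem[of f "\<lambda>x. (-1) * g x"] scale_mem[of g "-1"] by simp

lemma ip_diff_left:
  assumes "f \<in> H" "g \<in> H" "h \<in> H"
  shows "ip (\<lambda>x. f x - g x) h = ip f h - ip g h"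
  using ip_add_left[of f "\<lambda>x. (-1) * g x" h] scale_mem[of g "-1"] ip_scale_left[of g h "-1"] assms
  by simp

lemma ip_add_right:
  assumes "f \<in> H" "g \<in> H" "h \<in> H"
  shows "ip h (\<lambda>x. f x + g x) = ip h f + ip h g"
  using assms by (simp add: ip_commute[of h] add_mem ip_add_left)

lemma ip_diff_right:
  assumes "f \<in> H" "g \<in> H" "h \<in> H"
  shows "ip h (\<lambda>x. f x - g x) = ip h f - ip h g"
  using assms by (simp add: ip_commute[of h] diff_mem ip_diff_left)

lemma ip_scale_right:
  assumes "f \<in> H" "h \<in> H"
  shows "ip h (\<lambda>x. c * f x) = c * ip h f"
  using assms by (simp add: ip_commute[of h] scale_mem ip_scale_left)

lemmas ip_linear = add_mem diff_mem scale_mem ip_add_left ip_add_right ip_diff_left ip_diff_right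
  ip_scale_left ip_scale_right

lemma ip_sum_square:
  assumes "f \<in> H" "g \<in> H"
  shows "ip (\<lambda>x. f x + t * g x) (\<lambda>x. f x + t * g x) = ip f f + 2 * t * ip f g + t\<^sup>2 * ip g g"
  using assms ip_commute[of f g]
  by (simp add: ip_linear) (simp add: algebra_simps power2_eq_square)

lemma ip_cauchy_schwarz:
  assumes "f \<in> H" "g \<in> H"
  shows "\<bar>ip f g\<bar> \<le> sqrt (ip f f) * sqrt (ip g g)"
proof (cases "ip g g = 0")
  case True
  then have "g = (\<lambda>x. 0)" using ip_definite assms by blast
  then have "ip f g = 0" using ip_scale_right[of g f 0] assms by simp
  then show ?thesis using True by simp
next
  case False
  then have pos: "0 < ip g g" using ip_nonneg[of g] assms by simp
  \<comment> \<open>This \<open>t\<close> minimizes the quadratic of \<open>ip_sum_square\<close>,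
    so nonnegativity there is the sharpest available.\<close>
  define t where "t = - ip f g / ip g g"
  have "0 \<le> ip f f + 2 * t * ip f g + t\<^sup>2 * ip g g"
    using ip_nonneg[of "\<lambda>x. f x + t * g x"] ip_sum_square[of f g t] assms
    by (simp add: add_mem scale_mem)
  also have "\<dots> = ip f f - (ip f g)\<^sup>2 / ip g g"
    using pos by (simp add: t_def field_simps power2_eq_square)
  finally have "(ip f g)\<^sup>2 \<le> ip f f * ip g g" using pos by (simp add: field_simps)
  then show ?thesis
    using real_le_rsqrt[of "\<bar>ip f g\<bar>" "ip f f * ip g g"] by (simp add: real_sqrt_mult)
qed

lemma ip_norm_triangle:
  assumes "f \<in> H" "g \<in> H"
  shows "sqrt (ip (\<lambda>x. f x + g x) (\<lambda>x. f x + g x)) \<le> sqrt (ip f f) + sqrt (ip g g)"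
proof (rule real_le_lsqrt)
  show "0 \<le> sqrt (ip f f) + sqrt (ip g g)" using assms ip_nonneg by simp
  have "ip (\<lambda>x. f x + g x) (\<lambda>x. f x + g x) = ip f f + 2 * ip f g + ip g g"
    using ip_sum_square[of f g 1] assms by simp
  then show "ip (\<lambda>x. f x + g x) (\<lambda>x. f x + g x) \<le> (sqrt (ip f f) + sqrt (ip g g))\<^sup>2"
    using ip_cauchy_schwarz[OF assms] assms ip_nonneg by (simp add: power2_sum)
qed

text \<open>
  Boundedness of the functional enters as a lower bound for the Dirichlet energy, whose
  minimizer is the representing vector.
\<close>

lemma riesz_representation:
  assumes add: "\<And>f g. f \<in> H \<Longrightarrow> g \<in> H \<Longrightarrow> \<phi> (\<lambda>x. f x + g x) = \<phi> f + \<phi> g"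
    and scale: "\<And>c f. f \<in> H \<Longrightarrow> \<phi> (\<lambda>x. c * f x) = c * \<phi> f"
    and bound: "\<And>h. h \<in> H \<Longrightarrow> B \<le> ip h h - 2 * \<phi> h"
  obtains g where "g \<in> H" "\<And>h. h \<in> H \<Longrightarrow> \<phi> h = ip h g"
proof -
  define J where "J h = ip h h - 2 * \<phi> h" for h
  define m where "m = (INF h\<in>H. J h)"
  have bdd: "bdd_below (J ` H)" using bound by (auto simp: J_def intro!: bdd_belowI)
  have m_le: "m \<le> J h" if "h \<in> H" for h
    unfolding m_def using bdd that by (rule cINF_lower)
  have "\<exists>u\<in>H. J u < m + 1 / real (Suc n)" for n
    using cINF_less_iff[of H J "m + 1 / real (Suc n)"] bdd zero_mem by (auto simp: m_def)
  then obtain u where uH: "\<And>n. u n \<in> H" and uJ: "\<And>n. J (u n) < m + 1 / real (Suc n)"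
    by metis
  \<comment> \<open>The linear part of \<open>J\<close> is affine and cancels against the midpoint,
    leaving the parallelogram law. The midpoint has energy at least \<open>m\<close>, so two
    near-minimizers are close and \<open>u\<close> is Cauchy.\<close>
  have parallelogram: "ip (\<lambda>x. f x - g x) (\<lambda>x. f x - g x) \<le> 2 * (J f + J g) - 4 * m"
    if "f \<in> H" "g \<in> H" for f g
  proof -
    let ?mid = "\<lambda>x. (1/2) * f x + (1/2) * g x"
    have "\<phi> ?mid = (1/2) * \<phi> f + (1/2) * \<phi> g"
      using that by (simp only: add scale scale_mem)
    moreover have "ip ?mid ?mid = (1/4) * ip f f + (1/2) * ip f g + (1/4) * ip g g"
      using that ip_commute[of f g] by (simp only: ip_linear)
    moreover have "ip (\<lambda>x. f x - g x) (\<lambda>x. f x - g x) = ip f f - 2 * ip f g + ip g g"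
      using that ip_commute[of f g] by (simp add: ip_linear)
    ultimately have "ip (\<lambda>x. f x - g x) (\<lambda>x. f x - g x) = 2 * (J f + J g) - 4 * J ?mid"
      by (simp add: J_def)
    also have "\<dots> \<le> 2 * (J f + J g) - 4 * m"
      using m_le[of ?mid] add_mem[OF scale_mem scale_mem, of f g "1/2" "1/2"] that by simp
    finally show ?thesis .
  qed
  have "\<exists>N. \<forall>i\<ge>N. \<forall>j\<ge>N. sqrt (ip (\<lambda>x. u i x - u j x) (\<lambda>x. u i x - u j x)) < e"
    if "0 < e" for e
  proof -
    \<comment> \<open>Two excesses below \<open>e\<^sup>2 / 4\<close> enter
      \<open>parallelogram\<close> with factor 2, which gives exactly
      \<open>e\<^sup>2\<close>.\<close>
    obtain N where N: "inverse (real (Suc N)) < e\<^sup>2 / 4"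
      using reals_Archimedean[of "e\<^sup>2 / 4"] \<open>0 < e\<close> by (metis divide_pos_pos zero_less_power zero_less_numeral)
    have "sqrt (ip (\<lambda>x. u i x - u j x) (\<lambda>x. u i x - u j x)) < e" if "N \<le> i" "N \<le> j" for i j
    proof -
      have "J (u i) < m + e\<^sup>2 / 4" "J (u j) < m + e\<^sup>2 / 4"
        using uJ[of i] uJ[of j] N that
          frac_le[of 1 1 "real (Suc N)" "real (Suc i)"] frac_le[of 1 1 "real (Suc N)" "real (Suc j)"]
        by (auto simp: inverse_eq_divide)
      then have "ip (\<lambda>x. u i x - u j x) (\<lambda>x. u i x - u j x) < e\<^sup>2"
        using parallelogram[OF uH uH, of i j] by simp
      then show ?thesis using \<open>0 < e\<close> by (simp add: real_less_lsqrt)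
    qed
    then show ?thesis by blast
  qed
  then obtain g where gH: "g \<in> H"
    and lim: "(\<lambda>n. sqrt (ip (\<lambda>x. u n x - g x) (\<lambda>x. u n x - g x))) \<longlonglongrightarrow> 0"
    using complete[of u] uH by blast
  have "\<phi> h = ip h g" if hH: "h \<in> H" for h
  proof -
    have "(\<lambda>n. ip (u n) h - ip g h) \<longlonglongrightarrow> 0"
    proof (rule Lim_null_comparison)
      show "\<forall>\<^sub>F n in sequentially. norm (ip (u n) h - ip g h)
          \<le> sqrt (ip (\<lambda>x. u n x - g x) (\<lambda>x. u n x - g x)) * sqrt (ip h h)"
        using ip_cauchy_schwarz[OF diff_mem[OF uH gH] hH] by (simp add: ip_diff_left uH gH hH)
      show "(\<lambda>n. sqrt (ip (\<lambda>x. u n x - g x) (\<lambda>x. u n x - g x)) * sqrt (ip h h)) \<longlonglongrightarrow> 0"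
        using tendsto_mult_right[OF lim, of "sqrt (ip h h)"] by simp
    qed
    then have lim': "(\<lambda>n. ip (u n) h) \<longlonglongrightarrow> ip g h" by (simp add: LIM_zero_iff)
    define a where "a = ip g h - \<phi> h"
    \<comment> \<open>First variation of \<open>J\<close> at the minimizer, taken along
      \<open>u n\<close> and passed to the limit: moving by \<open>t * h\<close> cannot push
      \<open>J\<close> below \<open>m\<close>, and \<open>J (u n)\<close> exceeds \<open>m\<close>
      by less than \<open>1 / real (Suc n)\<close>.\<close>
    have variation: "0 \<le> 2 * t * a + t\<^sup>2 * ip h h" for t
    proof (rule LIMSEQ_le_const)
      show "(\<lambda>n. 1 / real (Suc n) + (2 * t * (ip (u n) h - \<phi> h) + t\<^sup>2 * ip h h))
          \<longlonglongrightarrow> 2 * t * a + t\<^sup>2 * ip h h"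
      proof -
        have "(\<lambda>n. 1 / real (Suc n)) \<longlonglongrightarrow> 0" by (rule LIMSEQ_Suc[OF lim_1_over_n])
        then have "(\<lambda>n. 1 / real (Suc n) + (2 * t * (ip (u n) h - \<phi> h) + t\<^sup>2 * ip h h))
            \<longlonglongrightarrow> 0 + (2 * t * (ip g h - \<phi> h) + t\<^sup>2 * ip h h)"
          by (intro tendsto_intros lim')
        then show ?thesis by (simp add: a_def)
      qed
      have "0 \<le> 1 / real (Suc n) + (2 * t * (ip (u n) h - \<phi> h) + t\<^sup>2 * ip h h)" for n
      proof -
        have "J (\<lambda>x. u n x + t * h x) = J (u n) + (2 * t * (ip (u n) h - \<phi> h) + t\<^sup>2 * ip h h)"
          using ip_sum_square[OF uH hH, of n t] add[OF uH scale_mem[OF hH], of n t] scale[OF hH, of t]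
          by (simp add: J_def algebra_simps)
        then show ?thesis
          using m_le[OF add_mem[OF uH scale_mem[OF hH]], of n t] uJ[of n] by linarith
      qed
      then show "\<exists>N. \<forall>n\<ge>N.
          0 \<le> 1 / real (Suc n) + (2 * t * (ip (u n) h - \<phi> h) + t\<^sup>2 * ip h h)" by blast
    qed
    have "a = 0"
    proof (rule ccontr)
      assume "a \<noteq> 0"
      \<comment> \<open>The added 1 keeps \<open>q\<close> positive even for \<open>h = 0\<close>;
        with \<open>t = - a / q\<close> the linear term outweighs the quadratic one.\<close>
      define q where "q = ip h h + 1"
      have q: "0 < q" "ip h h < q" using ip_nonneg[OF hH] by (simp_all add: q_def)
      have "0 \<le> 2 * (- a / q) * a + (- a / q)\<^sup>2 * ip h h" by (rule variation)
      also have "\<dots> \<le> 2 * (- a / q) * a + (- a / q)\<^sup>2 * q"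
        using q by (intro add_left_mono mult_left_mono) auto
      also have "\<dots> = - a\<^sup>2 / q" using q by (simp add: field_simps power2_eq_square)
      also have "\<dots> < 0" using q \<open>a \<noteq> 0\<close> by simp
      finally show False by simp
    qed
    then show ?thesis using ip_commute[OF gH hH] by (simp add: a_def)
  qed
  then show ?thesis using that gH by blast
qed

end

text \<open>Riesz representation applied to evaluation at \<open>x\<close> gives existence;
  uniqueness makes the definite description in \<open>kernel_section\<close> denote that
  vector.\<close>

lemma (in rkhs) kernel_section:
  shows kernel_section_mem: "kernel_section H ip x \<in> H"
    and kernel_section_reproducing: "h \<in> H \<Longrightarrow> h x = ip h (kernel_section H ip x)"
proof -
  obtain B where B: "\<And>h. h \<in> H \<Longrightarrow> \<bar>h x\<bar> \<le> B * sqrt (ip h h)"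
  proof (cases "x \<in> X")
    case True
    then show ?thesis using bounded_evaluation that by blast
  next
    case False
    \<comment> \<open>Off \<open>X\<close> every member of \<open>H\<close> vanishes, so evaluation
      there has bound 0.\<close>
    then show ?thesis using that[of 0] outside by simp
  qed
  \<comment> \<open>Completing the square turns the bound on evaluation into the energy bound
    required by \<open>riesz_representation\<close>.\<close>
  have "- B\<^sup>2 \<le> ip h h - 2 * h x" if "h \<in> H" for h
  proof -
    have "0 \<le> (sqrt (ip h h) - B)\<^sup>2" by simp
    then show ?thesis using B[OF that] ip_nonneg[OF that] by (simp add: power2_diff abs_le_iff algebra_simps)
  qed
  then obtain k where k: "k \<in> H" "\<And>h. h \<in> H \<Longrightarrow> h x = ip h k"
    using riesz_representation[of "\<lambda>h. h x" "- B\<^sup>2"] by auto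
  have unique: "k' = k" if "k' \<in> H \<and> (\<forall>h\<in>H. h x = ip h k')" for k'
  proof -
    have d: "(\<lambda>y. k' y - k y) \<in> H" using that k(1) by (blast intro: diff_mem)
    then have "ip (\<lambda>y. k' y - k y) (\<lambda>y. k' y - k y)
        = ip (\<lambda>y. k' y - k y) k' - ip (\<lambda>y. k' y - k y) k"
      using that k(1) by (blast intro: ip_diff_right)
    also have "\<dots> = 0" using that k(2)[OF d] d by (metis diff_self)
    finally have "ip (\<lambda>y. k' y - k y) (\<lambda>y. k' y - k y) = 0" .
    then have "(\<lambda>y. k' y - k y) = (\<lambda>y. 0)" using d by (intro ip_definite)
    then show ?thesis by (simp add: fun_eq_iff)
  qed
  have "kernel_section H ip x = k"
    unfolding kernel_section_def by (rule the_equality[OF _ unique]) (use k in blast)+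
  then show "kernel_section H ip x \<in> H" "h \<in> H \<Longrightarrow> h x = ip h (kernel_section H ip x)"
    using k by metis+
qed

section \<open>Square integrable functions and the L2 norm\<close>

lemma square_integrable_mult:
  assumes "square_integrable M f" "square_integrable M g"
  shows "integrable M (\<lambda>x. f x * g x)"
proof (rule Bochner_Integration.integrable_bound)
  show "integrable M (\<lambda>x. (f x)\<^sup>2 + (g x)\<^sup>2)" and "(\<lambda>x. f x * g x) \<in> borel_measurable M"
    using assms by (auto simp: square_integrable_def)
  have "\<bar>a * b\<bar> \<le> a\<^sup>2 + b\<^sup>2" for a b :: real
    using zero_le_power2[of "\<bar>a\<bar> - \<bar>b\<bar>"] abs_ge_zero[of "a * b"]
    unfolding power2_diff abs_mult power2_abs by linarith
  then show "AE x in M. norm (f x * g x) \<le> norm ((f x)\<^sup>2 + (g x)\<^sup>2)" by simp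
qed

lemma square_integrable_diff:
  assumes "square_integrable M f" "square_integrable M g"
  shows "square_integrable M (\<lambda>x. f x - g x)"
  using assms square_integrable_mult[OF assms]
  by (auto simp: square_integrable_def power2_diff mult.assoc)

lemma square_integrable_scale:
  "square_integrable M f \<Longrightarrow> square_integrable M (\<lambda>x. c * f x)"
  by (auto simp: square_integrable_def power_mult_distrib)

lemma integral_diff_square:
  assumes "square_integrable M f" "square_integrable M g"
  shows "(\<integral>x. (f x - g x)\<^sup>2 \<partial>M) = (\<integral>x. (f x)\<^sup>2 \<partial>M) - 2 * (\<integral>x. f x * g x \<partial>M) + (\<integral>x. (g x)\<^sup>2 \<partial>M)"
  using assms square_integrable_mult[OF assms]
  by (simp add: square_integrable_def power2_diff mult.assoc)

lemma square_integrable_restrict: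
  assumes "square_integrable M f" "S \<in> sets M"
  shows "square_integrable M (restrict_op S f)"
proof -
  have "(\<lambda>x. (restrict_op S f x)\<^sup>2) = (\<lambda>x. (f x)\<^sup>2 * indicator S x)"
    by (auto simp: restrict_op_def indicator_def)
  then show ?thesis
    using assms integrable_real_mult_indicator[of S M "\<lambda>x. (f x)\<^sup>2"]
    unfolding square_integrable_def by (auto simp: restrict_op_def[abs_def])
qed

lemma L2_norm_power2: "(L2_norm M f)\<^sup>2 = (\<integral>x. (f x)\<^sup>2 \<partial>M)"
  by (simp add: L2_norm_def)

lemma L2_norm_nonneg: "0 \<le> L2_norm M f"
  by (simp add: L2_norm_def)

section \<open>The kernel operator as orthogonal projection onto \<open>H\<close>\<close>

context L2_rkhs
begin

abbreviation K :: "('a \<Rightarrow> real) \<Rightarrow> 'a \<Rightarrow> real" where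
  "K \<equiv> kernel_op M (reproducing_kernel H ip)"

lemma integral_square_eq_ip: "f \<in> H \<Longrightarrow> (\<integral>x. (f x)\<^sup>2 \<partial>M) = ip f f"
  using isometric[of f] by (simp add: L2_norm_def)

text \<open>Polarization: the isometry is assumed for norms only, and comparing the two expansions
  of the squared norm of \<open>f - g\<close> extends it to inner products.\<close>

lemma integral_mult_eq_ip:
  assumes "f \<in> H" "g \<in> H"
  shows "(\<integral>x. f x * g x \<partial>M) = ip f g"
  using integral_diff_square[of M f g] assms ip_commute[of f g]
  by (simp add: square_integrable_mem integral_square_eq_ip ip_linear)

text \<open>Integration against \<open>f\<close> is a functional on \<open>H\<close> whose energy is
  bounded below because the integral of \<open>(f - h)\<^sup>2\<close> is nonnegative. Its Riesz
  vector \<open>g\<close> equals \<open>K f\<close> at every point, since \<open>K f x\<close> is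
  the functional evaluated at the kernel section of \<open>x\<close>.\<close>

lemma kernel_op_projection:
  assumes f: "square_integrable M f"
  shows kernel_op_mem: "K f \<in> H"
    and ip_kernel_op: "h \<in> H \<Longrightarrow> ip h (K f) = (\<integral>x. f x * h x \<partial>M)"
proof -
  define \<phi> where "\<phi> h = (\<integral>x. f x * h x \<partial>M)" for h
  have int: "integrable M (\<lambda>x. f x * h x)" if "h \<in> H" for h
    using square_integrable_mult f square_integrable_mem that by blast
  have "- (\<integral>x. (f x)\<^sup>2 \<partial>M) \<le> ip h h - 2 * \<phi> h" if "h \<in> H" for h
  proof -
    have "0 \<le> (\<integral>x. (f x - h x)\<^sup>2 \<partial>M)" by simp
    then show ?thesis
      using integral_diff_square[OF f square_integrable_mem[OF that]] that
      by (simp add: \<phi>_def integral_square_eq_ip)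
  qed
  moreover have "\<phi> (\<lambda>x. h x + h' x) = \<phi> h + \<phi> h'" if "h \<in> H" "h' \<in> H" for h h'
    using int that by (simp add: \<phi>_def distrib_left)
  moreover have "\<phi> (\<lambda>x. c * h x) = c * \<phi> h" for c h
    by (simp add: \<phi>_def mult.left_commute)
  ultimately obtain g where g: "g \<in> H" "\<And>h. h \<in> H \<Longrightarrow> \<phi> h = ip h g"
    using riesz_representation[of \<phi> "- (\<integral>x. (f x)\<^sup>2 \<partial>M)"] by blast
  have "K f x = g x" for x
  proof -
    let ?k = "kernel_section H ip"
    have "reproducing_kernel H ip x y = ?k x y" for y
      unfolding reproducing_kernel_def
      using kernel_section_reproducing[of "?k x" y] ip_commute kernel_section_mem by simp
    then have "K f x = \<phi> (?k x)" by (simp add: kernel_op_def \<phi>_def)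
    also have "\<dots> = g x"
      using g kernel_section_mem kernel_section_reproducing[of g x] ip_commute by simp
    finally show ?thesis .
  qed
  then have "K f = g" by auto
  then show "K f \<in> H" "h \<in> H \<Longrightarrow> ip h (K f) = (\<integral>x. f x * h x \<partial>M)"
    using g by (auto simp: \<phi>_def)
qed

text \<open>The difference \<open>K f - f\<close> lies in \<open>H\<close> and is orthogonal to all
  of \<open>H\<close>, hence to itself.\<close>

lemma kernel_op_ident:
  assumes "f \<in> H"
  shows "K f = f"
proof -
  let ?d = "\<lambda>x. K f x - f x"
  have mem: "K f \<in> H" using kernel_op_mem square_integrable_mem assms by blast
  have "ip h ?d = 0" if "h \<in> H" for h
    using ip_kernel_op[OF square_integrable_mem[OF assms] that] mem assms that
    by (simp add: ip_diff_right integral_mult_eq_ip ip_commute)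
  then have "?d = (\<lambda>x. 0)" using ip_definite diff_mem mem assms by blast
  then show ?thesis by (simp add: fun_eq_iff)
qed

text \<open>Pythagoras for \<open>h - f = (h - K f) + (K f - f)\<close>: the first summand lies in
  \<open>H\<close>, the second is orthogonal to \<open>H\<close>.\<close>

lemma integral_projection_error:
  assumes f: "square_integrable M f" and h: "h \<in> H"
  shows "(\<integral>x. (h x - f x)\<^sup>2 \<partial>M)
    = ip (\<lambda>x. h x - K f x) (\<lambda>x. h x - K f x) + ((\<integral>x. (f x)\<^sup>2 \<partial>M) - ip (K f) (K f))"
proof -
  have "(\<integral>x. h x * f x \<partial>M) = ip h (K f)"
    using ip_kernel_op[OF f h] by (simp add: mult.commute)
  then show ?thesis
    using integral_diff_square[OF square_integrable_mem[OF h] f] kernel_op_mem[OF f] h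
      ip_commute[of h "K f"]
    by (simp add: integral_square_eq_ip ip_linear)
qed

lemma integral_kernel_op_error:
  assumes "square_integrable M f"
  shows "(\<integral>x. (K f x - f x)\<^sup>2 \<partial>M) = (\<integral>x. (f x)\<^sup>2 \<partial>M) - ip (K f) (K f)"
  using integral_projection_error[OF assms kernel_op_mem[OF assms]] kernel_op_mem[OF assms]
    integral_square_eq_ip[OF zero_mem]
  by simp

section \<open>Commutators with restrictions and the Cheeger constant\<close>

lemma commutator_restrict:
  assumes "F \<in> H"
  shows "commutator K (restrict_op S) F = (\<lambda>x. K (restrict_op S F) x - restrict_op S F x)"
  by (rule ext) (simp add: commutator_def kernel_op_ident[OF assms])

lemma commutator_norm:
  assumes "F \<in> H" "S \<in> sets M"
  shows "(L2_norm M (commutator K (restrict_op S) F))\<^sup>2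
    = (L2_norm M (restrict_op S F))\<^sup>2 - ip (K (restrict_op S F)) (K (restrict_op S F))"
  using assms integral_kernel_op_error[of "restrict_op S F"] square_integrable_mem
  by (simp add: L2_norm_power2 commutator_restrict square_integrable_restrict)

lemma cheeger_constant_le:
  assumes "S \<in> cheeger_sets M F"
  shows "kernel_cheeger_constant M k F
    \<le> (L2_norm M (commutator (kernel_op M k) (restrict_op S) F))\<^sup>2
        / min ((L2_norm M (restrict_op S F))\<^sup>2) ((L2_norm M (restrict_op (space M - S) F))\<^sup>2)"
  unfolding kernel_cheeger_constant_def using assms
  by (auto intro!: cINF_lower bdd_belowI[of _ 0])

lemma cheeger_constant_nonneg: "0 \<le> kernel_cheeger_constant M k F"
  unfolding kernel_cheeger_constant_def by (auto intro!: cINF_greatest)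

lemma cheeger_sets_compl:
  assumes "S \<in> cheeger_sets M F"
  shows "space M - S \<in> cheeger_sets M F"
proof -
  have "S \<subseteq> space M" using assms by (auto simp: cheeger_sets_def dest: sets.sets_into_space)
  then have "space M - (space M - S) = S" by blast
  then show ?thesis using assms by (auto simp: cheeger_sets_def)
qed

text \<open>When \<open>S\<close> carries the smaller part of \<open>F\<close>, the minimum in the
  Cheeger quotient is the positive number attached to \<open>S\<close>, and the denominator can be
  cleared.\<close>

lemma cheeger_constant_le_smaller:
  assumes "S \<in> cheeger_sets M F"
    and "L2_norm M (restrict_op S F) \<le> L2_norm M (restrict_op (space M - S) F)"
  shows "kernel_cheeger_constant M k F * (L2_norm M (restrict_op S F))\<^sup>2
    \<le> (L2_norm M (commutator (kernel_op M k) (restrict_op S) F))\<^sup>2"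
proof -
  have pos: "0 < L2_norm M (restrict_op S F)" using assms(1) by (simp add: cheeger_sets_def)
  then have "min ((L2_norm M (restrict_op S F))\<^sup>2) ((L2_norm M (restrict_op (space M - S) F))\<^sup>2)
      = (L2_norm M (restrict_op S F))\<^sup>2"
    using assms(2) by (simp add: min_def power_mono)
  then show ?thesis
    using cheeger_constant_le[OF assms(1), of k] pos by (simp add: pos_le_divide_eq)
qed

text \<open>For an admissible set, it or its complement carries the smaller part, and there
  \<open>commutator_norm\<close> bounds the numerator by the denominator. This makes
  \<open>1 / c - 1\<close> nonnegative for the square root later on.\<close>

lemma cheeger_constant_le_one:
  assumes "F \<in> H"
  shows "kernel_cheeger_constant M (reproducing_kernel H ip) F \<le> 1"
proof (cases "cheeger_sets M F = {}")
  case True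
  then show ?thesis by (simp add: kernel_cheeger_constant_def)
next
  case False
  then obtain S where S: "S \<in> cheeger_sets M F" by blast
  obtain T where T: "T \<in> cheeger_sets M F"
    and le: "L2_norm M (restrict_op T F) \<le> L2_norm M (restrict_op (space M - T) F)"
  proof (cases "L2_norm M (restrict_op S F) \<le> L2_norm M (restrict_op (space M - S) F)")
    case True
    then show ?thesis using that S by blast
  next
    case False
    have "space M - (space M - S) = S"
      using S by (auto simp: cheeger_sets_def dest: sets.sets_into_space)
    then show ?thesis using that[of "space M - S"] cheeger_sets_compl[OF S] False by simp
  qed
  have T': "T \<in> sets M" "0 < L2_norm M (restrict_op T F)"
    using T by (auto simp: cheeger_sets_def)
  have "K (restrict_op T F) \<in> H"
    using kernel_op_mem square_integrable_restrict square_integrable_mem assms T' by blast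
  then have "kernel_cheeger_constant M (reproducing_kernel H ip) F * (L2_norm M (restrict_op T F))\<^sup>2
      \<le> 1 * (L2_norm M (restrict_op T F))\<^sup>2"
    using cheeger_constant_le_smaller[OF T le, of "reproducing_kernel H ip"]
      commutator_norm[OF assms T'(1)] ip_nonneg by fastforce
  then show ?thesis using T'(2) by (simp add: mult_le_cancel_right)
qed

section \<open>The stability estimate with real constants\<close>

text \<open>Stated for a general \<open>W\<close> in \<open>H\<close> so that it serves both
  \<open>F + G\<close> and \<open>F - G\<close>; the error \<open>E\<close> of the overview is
  \<open>W - 2 * Q\<close>.\<close>

lemma norm_le_of_small_part:
  fixes F W :: "'a \<Rightarrow> real"
  defines "c \<equiv> kernel_cheeger_constant M (reproducing_kernel H ip) F"
  assumes F: "F \<in> H" and W: "W \<in> H" and S: "S \<in> sets M" and c: "0 < c"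
    and le: "L2_norm M (restrict_op S F) \<le> L2_norm M (restrict_op (space M - S) F)"
  shows "L2_norm M W \<le> (2 * sqrt (1 / c - 1) + 1) * L2_norm M (\<lambda>x. W x - 2 * restrict_op S F x)"
proof -
  define Q where "Q = restrict_op S F"
  define b where "b = (L2_norm M (commutator K (restrict_op S) F))\<^sup>2"
  define d where "d = L2_norm M (\<lambda>x. W x - 2 * Q x)"
  have Q: "square_integrable M Q"
    using F S by (simp add: Q_def square_integrable_restrict square_integrable_mem)
  have KQ: "K Q \<in> H" using Q by (rule kernel_op_mem)
  have b: "b = (L2_norm M Q)\<^sup>2 - ip (K Q) (K Q)"
    unfolding b_def Q_def by (rule commutator_norm[OF F S])
  have cQ: "c * (L2_norm M Q)\<^sup>2 \<le> b"
  proof (cases "S \<in> cheeger_sets M F")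
    case True
    then show ?thesis
      using cheeger_constant_le_smaller[OF True le, of "reproducing_kernel H ip"]
      by (simp add: c_def b_def Q_def)
  next
    case False
    \<comment> \<open>A measurable set fails to be admissible only if one of the two parts has norm
      zero, and then the smaller one does.\<close>
    then have "L2_norm M Q = 0"
      using S le L2_norm_nonneg[of M Q] by (force simp: cheeger_sets_def Q_def)
    then show ?thesis by (simp add: b_def)
  qed
  have r: "0 \<le> 1 / c - 1" using c cheeger_constant_le_one[OF F] by (simp add: c_def)
  have "(L2_norm M Q)\<^sup>2 \<le> b / c" using cQ c by (simp add: field_simps)
  moreover have "(1 / c - 1) * b = b / c - b" by (simp add: left_diff_distrib)
  ultimately have KQ_le: "ip (K Q) (K Q) \<le> (1 / c - 1) * b" using b by linarith
  have "K (\<lambda>x. 2 * Q x) = (\<lambda>x. 2 * K Q x)"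
    by (simp add: kernel_op_def mult.assoc fun_eq_iff)
  \<comment> \<open>Projection identity for \<open>2 * Q\<close>: the distance from \<open>W\<close>
    splits into a component in \<open>H\<close> and an orthogonal one of squared norm
    \<open>4 * b\<close>.\<close>
  then have d: "d\<^sup>2 = ip (\<lambda>x. W x - 2 * K Q x) (\<lambda>x. W x - 2 * K Q x) + 4 * b"
    using integral_projection_error[OF square_integrable_scale[OF Q] W, of 2] b KQ
    by (simp add: d_def L2_norm_power2 power_mult_distrib ip_linear)
  have d0: "0 \<le> d" by (simp add: d_def L2_norm_nonneg)
  have b0: "0 \<le> b" by (simp add: b_def)
  have mem: "(\<lambda>x. 2 * K Q x) \<in> H" "(\<lambda>x. W x - 2 * K Q x) \<in> H"
    using W KQ by (auto intro!: ip_linear)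
  have "sqrt (ip (\<lambda>x. W x - 2 * K Q x) (\<lambda>x. W x - 2 * K Q x)) \<le> d"
    using d b0 d0 by (intro real_le_lsqrt) auto
  moreover have "sqrt (ip (\<lambda>x. 2 * K Q x) (\<lambda>x. 2 * K Q x)) \<le> 2 * sqrt (1 / c - 1) * d"
  proof -
    \<comment> \<open>Weaker than \<open>4 * b \<le> d\<^sup>2\<close>, which \<open>d\<close> also
      gives; the lost factor is the 2 in front of the square root.\<close>
    have "b \<le> d\<^sup>2" using d b0 ip_nonneg[OF mem(2)] by simp
    then have "ip (K Q) (K Q) \<le> (1 / c - 1) * d\<^sup>2"
      using KQ_le mult_left_mono[OF _ r] by (blast intro: order_trans)
    then have "sqrt (ip (K Q) (K Q)) \<le> sqrt (1 / c - 1) * d"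
      using d0 by (metis real_sqrt_le_iff real_sqrt_mult real_sqrt_abs abs_of_nonneg)
    then show ?thesis using KQ scale_mem[OF KQ, of 2] by (simp add: ip_linear real_sqrt_mult)
  qed
  moreover have "L2_norm M W \<le> sqrt (ip (\<lambda>x. W x - 2 * K Q x) (\<lambda>x. W x - 2 * K Q x))
      + sqrt (ip (\<lambda>x. 2 * K Q x) (\<lambda>x. 2 * K Q x))"
    using ip_norm_triangle[OF mem(2,1)] isometric[OF W] by simp
  ultimately show ?thesis by (simp add: d_def Q_def algebra_simps)
qed

lemma stability_estimate:
  fixes F :: "'a \<Rightarrow> real"
  defines "c \<equiv> kernel_cheeger_constant M (reproducing_kernel H ip) F"
  assumes F: "F \<in> H" and G: "G \<in> H" and c: "0 < c"
  shows "min (L2_norm M (\<lambda>x. F x - G x)) (L2_norm M (\<lambda>x. F x + G x))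
    \<le> (2 * sqrt (1 / c - 1) + 1) * L2_norm M (\<lambda>x. \<bar>F x\<bar> - \<bar>G x\<bar>)"
proof -
  \<comment> \<open>Agreement of signs, zeros included; the complement of \<open>S\<close> is the
    set \<open>T\<close> of the overview.\<close>
  define S where "S = {x \<in> space M. 0 \<le> F x * G x}"
  have [measurable]: "F \<in> borel_measurable M" "G \<in> borel_measurable M"
    using square_integrable_mem F G by (auto simp: square_integrable_def)
  have S: "S \<in> sets M" unfolding S_def by measurable
  have norm_eq: "L2_norm M f = L2_norm M (\<lambda>x. \<bar>F x\<bar> - \<bar>G x\<bar>)"
    if eq: "\<And>x. x \<in> space M \<Longrightarrow> \<bar>f x\<bar> = \<bar>\<bar>F x\<bar> - \<bar>G x\<bar>\<bar>" for f
  proof -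
    have "(f x)\<^sup>2 = (\<bar>F x\<bar> - \<bar>G x\<bar>)\<^sup>2" if "x \<in> space M" for x
      using eq[OF that] by (simp only: abs_eq_iff power2_eq_iff)
    then show ?thesis
      unfolding L2_norm_def by (auto intro!: arg_cong[where f = sqrt] Bochner_Integration.integral_cong)
  qed
  show ?thesis
  proof (cases "L2_norm M (restrict_op S F) \<le> L2_norm M (restrict_op (space M - S) F)")
    case True
    \<comment> \<open>Subtracting \<open>2 * F\<close> on \<open>S\<close> leaves
      \<open>G - F\<close> where the signs agree and \<open>F + G\<close> where they differ, so the
      modulus is the same in both regions. In the other case the roles of \<open>S\<close> and its
      complement are exchanged, with \<open>F - G\<close>.\<close>
    have "\<bar>F x + G x - 2 * restrict_op S F x\<bar> = \<bar>\<bar>F x\<bar> - \<bar>G x\<bar>\<bar>" if "x \<in> space M" for x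
      using that by (auto simp: S_def restrict_op_def indicator_def zero_le_mult_iff)
    then have "L2_norm M (\<lambda>x. F x + G x - 2 * restrict_op S F x) = L2_norm M (\<lambda>x. \<bar>F x\<bar> - \<bar>G x\<bar>)"
      by (rule norm_eq)
    then show ?thesis
      using norm_le_of_small_part[OF F add_mem[OF F G] S _ True] c
      by (simp add: c_def min.coboundedI2)
  next
    case False
    have S': "space M - S \<in> sets M" "space M - (space M - S) = S"
      using S sets.sets_into_space by auto
    have "\<bar>F x - G x - 2 * restrict_op (space M - S) F x\<bar> = \<bar>\<bar>F x\<bar> - \<bar>G x\<bar>\<bar>" if "x \<in> space M" for x
      using that by (auto simp: S_def restrict_op_def indicator_def zero_le_mult_iff)
    then have "L2_norm M (\<lambda>x. F x - G x - 2 * restrict_op (space M - S) F x)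
        = L2_norm M (\<lambda>x. \<bar>F x\<bar> - \<bar>G x\<bar>)"
      by (rule norm_eq)
    then show ?thesis
      using norm_le_of_small_part[OF F diff_mem[OF F G] S'(1)] c False S'(2)
      by (simp add: c_def min.coboundedI1)
  qed
qed

end

section \<open>Passage to extended real constants\<close>

theorem theorem3p10:
  fixes M :: "'a measure"
    and H :: "('a \<Rightarrow> real) set"
    and ip :: "('a \<Rightarrow> real) \<Rightarrow> ('a \<Rightarrow> real) \<Rightarrow> real"
    and F :: "'a \<Rightarrow> real"
  assumes "L2_rkhs M H ip"
    and "F \<in> H"
    and "F \<noteq> (\<lambda>x. 0)"
  shows "local_stability_constant M H F
           \<le> 2 * ereal_sqrt (inverse (ereal (kernel_cheeger_constant M (reproducing_kernel H ip) F)) - 1) + 1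
       \<and> (kernel_cheeger_constant M (reproducing_kernel H ip) F > 0
            \<longrightarrow> locally_stable_sign_retrieval M H F)"
proof -
  interpret L2_rkhs M H ip by fact
  define c where "c = kernel_cheeger_constant M (reproducing_kernel H ip) F"
  have "0 \<le> c" by (simp add: c_def cheeger_constant_nonneg)
  show ?thesis
  proof (cases "c = 0")
    case True
    \<comment> \<open>Here the extended inverse is \<open>\<infinity>\<close>, so the bound is
      trivial.\<close>
    then show ?thesis by (simp add: c_def[symmetric] ereal_sqrt_def)
  next
    case False
    with \<open>0 \<le> c\<close> have c: "0 < c" by simp
    define C where "C = 2 * sqrt (1 / c - 1) + 1"
    \<comment> \<open>The real \<open>sqrt\<close> is negative on negative arguments, so positivity
      of \<open>C\<close> rests on \<open>c \<le> 1\<close>.\<close>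
    have "0 \<le> sqrt (1 / c - 1)"
      using c cheeger_constant_le_one[OF assms(2)] by (simp add: c_def)
    then have "0 < C" unfolding C_def by linarith
    then have le: "local_stability_constant M H F \<le> ereal C"
      unfolding local_stability_constant_def
      using stability_estimate[OF assms(2)] c by (auto intro!: Inf_lower simp: C_def c_def)
    have "2 * ereal_sqrt (inverse (ereal c) - 1) + 1 = ereal C"
      using c by (simp add: C_def ereal_sqrt_def one_ereal_def inverse_eq_divide numeral_eq_ereal)
    then show ?thesis
      using le by (auto simp: c_def[symmetric] locally_stable_sign_retrieval_def
          intro: le_less_trans[of _ "ereal C"])
  qed
qed

end
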